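(* For any even integer $k\geq 2$, any $P_k$-design of order $n$ with $n\equiv 0,1\pmod{k-1}$ can be embedded into a $P_k$-design of any order $m>n+1$ with $m\equiv 0,1\pmod{k-1}$.
   Context: $K_n$ is the complete graph on $n$ vertices and $P_k$ is the path with $k$ vertices and $k-1$ edges. For graphs $\Gamma\leq K$ ($\Gamma$ isomorphic to a subgraph of $K$), a $(K,\Gamma)$-design is a set of subgraphs of $K$, each isomorphic to $\Gamma$, whose edge sets partition $E(K)$. A $P_k$-design of order $n$ is a $(K_n,P_k)$-design; in particular $P_k\leq K_n$. A $(K_n,P_k)$-design $\mathcal B$ is embedded into a $(K_m,P_k)$-design $\mathcal B'$ if $V(K_n)\subseteq V(K_m)$ and $\mathcal B\subseteq\mathcal B'$. *)

theory Defs
  imports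
    "HOL-Library.Disjoint_Sets"
    "HOL-Library.Infinite_Typeclass"
    "HOL-Number_Theory.Cong"
begin

datatype 'a sgraph = SGraph (verts: "'a set") (edges: "'a set set")

definition simple_graph :: "'a sgraph \<Rightarrow> bool" where
  "simple_graph G \<longleftrightarrow> (\<forall>e \<in> edges G. e \<subseteq> verts G \<and> card e = 2)"

definition is_subgraph :: "'a sgraph \<Rightarrow> 'a sgraph \<Rightarrow> bool" where
  "is_subgraph H G \<longleftrightarrow> simple_graph H \<and> simple_graph G \<and> verts H \<subseteq> verts G \<and> edges H \<subseteq> edges G"

definition graph_iso :: "'a sgraph \<Rightarrow> 'b sgraph \<Rightarrow> bool" where
  "graph_iso G H \<longleftrightarrow>
     (\<exists>f. bij_betw f (verts G) (verts H) \<and>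
          (\<forall>u \<in> verts G. \<forall>v \<in> verts G. {u, v} \<in> edges G \<longleftrightarrow> {f u, f v} \<in> edges H))"

definition complete_graph :: "'a set \<Rightarrow> 'a sgraph" where
  "complete_graph V = SGraph V {e. e \<subseteq> V \<and> card e = 2}"

(* The index k counts vertices, so path_graph k has k - 1 edges. *)
definition path_graph :: "nat \<Rightarrow> nat sgraph" where
  "path_graph k = SGraph {..<k} {{i, Suc i} | i. Suc i < k}"

definition iso_to_subgraph :: "'b sgraph \<Rightarrow> 'a sgraph \<Rightarrow> bool" where
  "iso_to_subgraph \<Gamma> K \<longleftrightarrow> (\<exists>H. is_subgraph H K \<and> graph_iso H \<Gamma>)"

(* Injectivity is needed because the image edges ` \<B> would not notice two different blocks
   with the same edge set. *)
definition graph_design :: "'a sgraph \<Rightarrow> 'b sgraph \<Rightarrow> 'a sgraph set \<Rightarrow> bool" where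
  "graph_design K \<Gamma> \<B> \<longleftrightarrow>
     iso_to_subgraph \<Gamma> K \<and>
     (\<forall>H \<in> \<B>. is_subgraph H K \<and> graph_iso H \<Gamma>) \<and>
     inj_on edges \<B> \<and> partition_on (edges K) (edges ` \<B>)"

definition path_design :: "nat \<Rightarrow> nat \<Rightarrow> 'a set \<Rightarrow> 'a sgraph set \<Rightarrow> bool" where
  "path_design k n V \<B> \<longleftrightarrow>
     finite V \<and> card V = n \<and> graph_design (complete_graph V) (path_graph k) \<B>"

definition design_embedded :: "'a set \<Rightarrow> 'a sgraph set \<Rightarrow> 'a set \<Rightarrow> 'a sgraph set \<Rightarrow> bool" where
  "design_embedded V \<B> W \<B>' \<longleftrightarrow> V \<subseteq> W \<and> \<B> \<subseteq> \<B>'"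

end

theory Submission
  imports Defs
begin

text \<open>Put \<open>q = k - 1\<close>, an odd number. It suffices to add \<open>q\<close> points at a time, and to pass once
  from order \<open>a q\<close> to \<open>(a + 1) q + 1\<close> or from \<open>a q + 1\<close> to \<open>(a + 1) q\<close>. If \<open>S\<close> is the set
  of new points and \<open>V\<close> the set of old ones, the edges to be decomposed are those of \<open>K\<^sub>S\<close> and
  those between \<open>S\<close> and \<open>V\<close>.
  If \<open>|S| = q\<close>, one old point \<open>v\<close> is added to \<open>S\<close>, and \<open>K\<^sub>k\<close> on \<open>S \<union> {v}\<close> splits into
  Hamiltonian paths; the rest consists of copies of \<open>K\<^bsub>q,q\<^esub>\<close> and perhaps one \<open>K\<^bsub>q,q-1\<^esub>\<close>, which
  are decomposed cyclically.
  If \<open>|S| = q + 1\<close>, then \<open>K\<^sub>S\<close> itself splits into Hamiltonian paths and copies of \<open>K\<^bsub>q+1,q\<^esub>\<close> remain.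
  If \<open>|S| = q - 1\<close>, the Hamiltonian paths of \<open>K\<^sub>S\<close> are too short by two edges and are prolonged
  into \<open>V\<close> at both ends.\<close>

section \<open>Edge sets that split into paths\<close>

definition path_edges :: "nat \<Rightarrow> (nat \<Rightarrow> 'a) \<Rightarrow> 'a set set" where
  "path_edges k p = (\<lambda>j. {p j, p (Suc j)}) ` {..<k - 1}"

text \<open>A path is a function listing its vertices, read only at arguments below
  \<open>k\<close>. For \<open>k \<ge> 2\<close> path edge sets are nonempty, so the disjointness
  clause also forbids that \<open>P\<close> contains one path twice, say in both directions.\<close>

definition path_decomposable :: "nat \<Rightarrow> 'a set set \<Rightarrow> bool" where
  "path_decomposable k E \<longleftrightarrow>
     (\<exists>P. (\<forall>p\<in>P. inj_on p {..<k}) \<and> E = (\<Union>p\<in>P. path_edges k p) \<and>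
          (\<forall>p\<in>P. \<forall>p'\<in>P. p \<noteq> p' \<longrightarrow> path_edges k p \<inter> path_edges k p' = {}))"

abbreviation all_edges :: "'a set \<Rightarrow> 'a set set" where
  "all_edges X \<equiv> {e. e \<subseteq> X \<and> card e = 2}"

text \<open>Meant for disjoint \<open>X\<close> and \<open>Y\<close>, where it is the edge set of a
  complete bipartite graph; a common element would contribute a singleton instead of an
  edge.\<close>

definition cross_edges :: "'a set \<Rightarrow> 'a set \<Rightarrow> 'a set set" where
  "cross_edges X Y = (\<lambda>(x, y). {x, y}) ` (X \<times> Y)"

lemma path_decomposable_empty: "path_decomposable k {}"
  unfolding path_decomposable_def by (rule exI[of _ "{}"]) simp

lemma path_decomposable_Un:
  assumes "path_decomposable k E" "path_decomposable k F" "E \<inter> F = {}"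
  shows "path_decomposable k (E \<union> F)"
proof -
  obtain P where P: "\<forall>p\<in>P. inj_on p {..<k}" "E = (\<Union>p\<in>P. path_edges k p)"
    "\<forall>p\<in>P. \<forall>p'\<in>P. p \<noteq> p' \<longrightarrow> path_edges k p \<inter> path_edges k p' = {}"
    using assms(1) unfolding path_decomposable_def by blast
  obtain Q where Q: "\<forall>p\<in>Q. inj_on p {..<k}" "F = (\<Union>p\<in>Q. path_edges k p)"
    "\<forall>p\<in>Q. \<forall>p'\<in>Q. p \<noteq> p' \<longrightarrow> path_edges k p \<inter> path_edges k p' = {}"
    using assms(2) unfolding path_decomposable_def by blast
  have "path_edges k p \<inter> path_edges k p' = {}" if "p \<in> P" "p' \<in> Q" for p p'
    using that assms(3) P(2) Q(2) by blast
  then have *: "\<forall>p\<in>P \<union> Q. \<forall>p'\<in>P \<union> Q. p \<noteq> p' \<longrightarrow> path_edges k p \<inter> path_edges k p' = {}"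
    using P(3) Q(3) by (metis Un_iff inf_commute)
  show ?thesis unfolding path_decomposable_def
    by (rule exI[of _ "P \<union> Q"]) (use P(1,2) Q(1,2) * in blast)
qed

text \<open>A match with exchanged ends would require \<open>i = Suc j\<close> and
  \<open>j = Suc i\<close> at once, so only the parallel match survives.\<close>

lemma path_edge_position_unique:
  assumes "inj_on p {..<k}" "Suc i < k" "Suc j < k" "{p i, p (Suc i)} = {p j, p (Suc j)}"
  shows "i = j"
proof -
  have "(p i = p j) = (i = j)" "(p (Suc i) = p j) = (Suc i = j)" "(p i = p (Suc j)) = (i = Suc j)"
    using inj_on_eq_iff[OF assms(1)] assms(2,3) by auto
  then show ?thesis using assms(4) by (auto simp: doubleton_eq_iff)
qed

text \<open>The edges of the family cover \<open>E\<close> because there are just enough of them.\<close>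

lemma path_decomposableI:
  fixes p :: "'i \<Rightarrow> nat \<Rightarrow> 'a"
  assumes fin: "finite E" "finite I" and k: "k \<ge> 2"
    and card: "card E = card I * (k - 1)"
    and inj: "\<And>h. h \<in> I \<Longrightarrow> inj_on (p h) {..<k}"
    and edge: "\<And>h j. h \<in> I \<Longrightarrow> Suc j < k \<Longrightarrow> {p h j, p h (Suc j)} \<in> E"
    and unique: "\<And>h h' j j'. h \<in> I \<Longrightarrow> h' \<in> I \<Longrightarrow> Suc j < k \<Longrightarrow> Suc j' < k \<Longrightarrow>
        {p h j, p h (Suc j)} = {p h' j', p h' (Suc j')} \<Longrightarrow> h = h'"
  shows "path_decomposable k E"
proof -
  let ?e = "\<lambda>(h, j). {p h j, p h (Suc j)}"
  have "inj_on ?e (I \<times> {..<k - 1})"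
  proof (rule inj_onI, clarify)
    fix h j h' j'
    assume *: "h \<in> I" "h' \<in> I" "j < k - 1" "j' < k - 1"
      "{p h j, p h (Suc j)} = {p h' j', p h' (Suc j')}"
    then have "h = h'" using unique[of h h' j j'] by simp
    moreover from this have "j = j'" using * path_edge_position_unique[OF inj[of h], of j j'] by simp
    ultimately show "h = h' \<and> j = j'" by simp
  qed
  then have "card (?e ` (I \<times> {..<k - 1})) = card E"
    by (simp add: card_image card card_cartesian_product)
  moreover have "?e ` (I \<times> {..<k - 1}) \<subseteq> E" using edge by auto
  ultimately have "?e ` (I \<times> {..<k - 1}) = E" using fin card_subset_eq by blast
  then have E: "E = (\<Union>q\<in>p ` I. path_edges k q)" by (fastforce simp: path_edges_def)
  have "path_edges k q \<inter> path_edges k q' = {}" if q: "q \<in> p ` I" "q' \<in> p ` I" "q \<noteq> q'" for q q'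
  proof -
    obtain h h' where h: "q = p h" "h \<in> I" "q' = p h'" "h' \<in> I"
      using q(1,2) by (elim imageE)
    then have "h \<noteq> h'" using q(3) by blast
    show ?thesis
    proof (rule ccontr)
      assume "path_edges k q \<inter> path_edges k q' \<noteq> {}"
      then obtain j j' where "j < k - 1" "j' < k - 1" "{p h j, p h (Suc j)} = {p h' j', p h' (Suc j')}"
        by (auto simp: path_edges_def h)
      then show False using unique[of h h' j j'] h \<open>h \<noteq> h'\<close> by (auto simp: less_diff_conv)
    qed
  qed
  then show ?thesis unfolding path_decomposable_def
    by (intro exI[of _ "p ` I"] conjI E) (use inj in blast)+
qed

section \<open>Edges of complete and complete bipartite graphs\<close>

lemma finite_cross_edges: "finite X \<Longrightarrow> finite Y \<Longrightarrow> finite (cross_edges X Y)"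
  by (simp add: cross_edges_def)

lemma card_cross_edges:
  assumes "X \<inter> Y = {}"
  shows "card (cross_edges X Y) = card X * card Y"
proof -
  have "inj_on (\<lambda>(x, y). {x, y}) (X \<times> Y)"
    using assms by (auto simp: inj_on_def doubleton_eq_iff)
  then show ?thesis by (simp add: cross_edges_def card_image card_cartesian_product)
qed

lemma cross_edges_commute: "cross_edges X Y = cross_edges Y X"
  by (auto simp: cross_edges_def image_iff insert_commute)

lemma cross_edges_Un: "cross_edges X (Y \<union> Z) = cross_edges X Y \<union> cross_edges X Z"
  by (auto simp: cross_edges_def)

lemma cross_edges_singleton: "cross_edges X {v} = (\<lambda>x. {x, v}) ` X"
  by (auto simp: cross_edges_def)

lemma cross_edges_disjoint:
  assumes "X \<inter> Y = {}" "X \<inter> Z = {}" "Y \<inter> Z = {}"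
  shows "cross_edges X Y \<inter> cross_edges X Z = {}"
  using assms by (auto simp: cross_edges_def doubleton_eq_iff)

text \<open>Every cross edge has an end in \<open>Y\<close>, which \<open>S\<close> avoids.
  \<open>X\<close> may overlap \<open>S\<close>, as happens when \<open>S\<close> arises from
  \<open>X\<close> by adding one vertex.\<close>

lemma all_edges_cross_disjoint:
  assumes "S \<inter> Y = {}"
  shows "all_edges S \<inter> cross_edges X Y = {}"
  using assms by (auto simp: cross_edges_def)

lemma all_edges_Un:
  assumes "X \<inter> Y = {}"
  shows "all_edges (X \<union> Y) = all_edges X \<union> all_edges Y \<union> cross_edges X Y"
proof (intro equalityI subsetI)
  fix e assume "e \<in> all_edges (X \<union> Y)"
  then obtain x y where "e = {x, y}" "x \<noteq> y" "x \<in> X \<union> Y" "y \<in> X \<union> Y"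
    by (auto simp: card_2_iff)
  then show "e \<in> all_edges X \<union> all_edges Y \<union> cross_edges X Y"
    by (auto simp: cross_edges_def image_iff insert_commute)
qed (use assms in \<open>auto simp: cross_edges_def card_insert_if\<close>)

lemma all_edges_singleton: "all_edges {v} = {}"
  by (auto simp: card_2_iff)

section \<open>Cyclic decompositions of bipartite graphs\<close>

text \<open>Integer indices allow shifts in both directions before reduction modulo the
  cardinality.\<close>

lemma ex_int_enumeration:
  assumes "finite X"
  shows "\<exists>x :: int \<Rightarrow> 'a. bij_betw x {0..<int (card X)} X"
  using assms by (intro finite_same_card_bij) auto

lemma int_mod_eq_imp_eq:
  fixes a b c :: int
  assumes "a mod c = b mod c" "\<bar>a - b\<bar> < c"
  shows "a = b"
  using assms by (metis mod_eq_dvd_iff dvd_imp_le_int abs_of_nonneg abs_ge_zero less_le_not_le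
      eq_iff_diff_eq_0 order_less_le_trans linorder_not_le)

text \<open>The \<open>h\<close>-th path is
  \<open>a h 0, b h 0, a h 1, b h 1, ..., a h (r - 1), b h (r - 1)\<close>, whose
  \<open>j\<close>-th edge joins \<open>a h (Suc j div 2)\<close> and \<open>b h (j div 2)\<close>.
  By \<open>apart\<close> an \<open>a\<close>-vertex never equals a \<open>b\<close>-vertex, so two
  equal edges agree at their \<open>a\<close>-ends and at their \<open>b\<close>-ends.\<close>

lemma path_decomposable_alternating:
  fixes a b :: "'i \<Rightarrow> nat \<Rightarrow> 'a"
  assumes fin: "finite E" "finite I" and r: "r \<ge> 1"
    and card: "card E = card I * (2 * r - 1)"
    and inj: "\<And>h. h \<in> I \<Longrightarrow> inj_on (a h) {..<r}" "\<And>h. h \<in> I \<Longrightarrow> inj_on (b h) {..<r}"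
    and apart: "\<And>h h' i j. h \<in> I \<Longrightarrow> h' \<in> I \<Longrightarrow> i < r \<Longrightarrow> j < r \<Longrightarrow> a h i \<noteq> b h' j"
    and edge: "\<And>h j. h \<in> I \<Longrightarrow> j < 2 * r - 1 \<Longrightarrow> {a h (Suc j div 2), b h (j div 2)} \<in> E"
    and unique: "\<And>h h' j j'. h \<in> I \<Longrightarrow> h' \<in> I \<Longrightarrow> j < 2 * r - 1 \<Longrightarrow> j' < 2 * r - 1 \<Longrightarrow>
        a h (Suc j div 2) = a h' (Suc j' div 2) \<Longrightarrow> b h (j div 2) = b h' (j' div 2) \<Longrightarrow> h = h'"
  shows "path_decomposable (2 * r) E"
proof -
  define p where "p h j = (if even j then a h (j div 2) else b h (j div 2))" for h and j :: nat
  have pe: "{p h j, p h (Suc j)} = {a h (Suc j div 2), b h (j div 2)}" for h j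
    by (cases "even j") (auto simp: p_def elim!: evenE oddE)
  show ?thesis
  proof (rule path_decomposableI[where I = I and p = p])
    fix h assume h: "h \<in> I"
    show "inj_on (p h) {..<2 * r}"
    proof (rule inj_onI)
      fix i j assume ij: "i \<in> {..<2 * r}" "j \<in> {..<2 * r}" "p h i = p h j"
      then have lt: "i div 2 < r" "j div 2 < r" by auto
      have par: "even i = even j"
        using ij(3) apart[OF h h lt] apart[OF h h lt(2) lt(1)] by (auto simp: p_def split: if_splits)
      then have "i div 2 = j div 2"
        using ij(3) inj[OF h] lt by (auto simp: p_def inj_on_def split: if_splits)
      with par show "i = j" by (metis div_mult_mod_eq odd_iff_mod_2_eq_one even_iff_mod_2_eq_zero)
    qed
  next
    fix h h' j j'
    assume *: "h \<in> I" "h' \<in> I" "Suc j < 2 * r" "Suc j' < 2 * r"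
      "{p h j, p h (Suc j)} = {p h' j', p h' (Suc j')}"
    then have "a h (Suc j div 2) \<noteq> b h' (j' div 2)" by (intro apart) auto
    then show "h = h'" using * unique[of h h' j j'] unfolding pe by (auto simp: doubleton_eq_iff)
  qed (use fin r card edge pe in auto)
qed

text \<open>With indices modulo \<open>q = 2 * r - 1\<close>, the \<open>h\<close>-th path is
  \<open>x h, y h, x (h + 1), y (h - 1), x (h + 2), ...\<close>. The index difference along its
  \<open>j\<close>-th edge is \<open>j\<close>, and \<open>j\<close> runs once through all residues,
  so an edge determines first \<open>j\<close> and then \<open>h\<close>.\<close>

lemma path_decomposable_balanced_bipartite:
  assumes fin: "finite X" "finite Y" and XY: "X \<inter> Y = {}" and r: "r \<ge> 1"
    and card: "card X = 2 * r - 1" "card Y = 2 * r - 1"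
  shows "path_decomposable (2 * r) (cross_edges X Y)"
proof -
  define q where "q = int (2 * r - 1)"
  have q: "q = 2 * int r - 1" using r by (simp add: q_def of_nat_diff)
  then have q0: "q > 0" using r by simp
  obtain x where x: "bij_betw x {0..<q} X" using ex_int_enumeration[OF fin(1)] card q_def by metis
  obtain y where y: "bij_betw y {0..<q} Y" using ex_int_enumeration[OF fin(2)] card q_def by metis
  have x_eq: "x (i mod q) = x (j mod q) \<longleftrightarrow> i mod q = j mod q" for i j
    using inj_on_eq_iff[OF bij_betw_imp_inj_on[OF x], of "i mod q" "j mod q"] q0 by simp
  have y_eq: "y (i mod q) = y (j mod q) \<longleftrightarrow> i mod q = j mod q" for i j
    using inj_on_eq_iff[OF bij_betw_imp_inj_on[OF y], of "i mod q" "j mod q"] q0 by simp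
  have lt: "\<bar>int i - int j\<bar> < q" if "i < r" "j < r" for i j using that q by linarith
  have xX: "x (i mod q) \<in> X" for i using bij_betwE[OF x] q0 by simp
  have yY: "y (i mod q) \<in> Y" for i using bij_betwE[OF y] q0 by simp
  show ?thesis
  proof (rule path_decomposable_alternating[where I = "{0..<q}" and
        a = "\<lambda>h j. x ((h + int j) mod q)" and b = "\<lambda>h j. y ((h - int j) mod q)"])
    fix h
    show "inj_on (\<lambda>j. x ((h + int j) mod q)) {..<r}"
      by (rule inj_onI) (use lt in \<open>fastforce simp: x_eq dest: int_mod_eq_imp_eq\<close>)
    show "inj_on (\<lambda>j. y ((h - int j) mod q)) {..<r}"
      by (rule inj_onI) (use lt in \<open>fastforce simp: y_eq dest: int_mod_eq_imp_eq\<close>)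
  next
    fix h h' j j'
    assume *: "h \<in> {0..<q}" "h' \<in> {0..<q}" "j < 2 * r - 1" "j' < 2 * r - 1"
      "x ((h + int (Suc j div 2)) mod q) = x ((h' + int (Suc j' div 2)) mod q)"
      "y ((h - int (j div 2)) mod q) = y ((h' - int (j' div 2)) mod q)"
    have a: "(h + int (Suc j div 2)) mod q = (h' + int (Suc j' div 2)) mod q"
      and b: "(h - int (j div 2)) mod q = (h' - int (j' div 2)) mod q" using * x_eq y_eq by auto
    \<comment> \<open>The two shifts of the \<open>i\<close>-th edge, forward in \<open>X\<close>
      and backward in \<open>Y\<close>, add up to \<open>i\<close>.\<close>
    have s: "int (Suc i div 2) + int (i div 2) = int i" for i by presburger
    have "(h + int (Suc j div 2) - (h - int (j div 2))) mod q
        = (h' + int (Suc j' div 2) - (h' - int (j' div 2))) mod q"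
      using a b by (rule mod_diff_cong)
    then have "int j mod q = int j' mod q" using s[of j] s[of j'] by (simp add: algebra_simps)
    then have "j = j'" using * q0 by (simp add: q_def)
    then have "(h + int (Suc j div 2) - int (Suc j div 2)) mod q
        = (h' + int (Suc j div 2) - int (Suc j div 2)) mod q"
      using a by (intro mod_diff_cong) auto
    then show "h = h'" using * by simp
  next
    show "x ((h + int i) mod q) \<noteq> y ((h' - int j) mod q)" for h h' i j
      using xX yY XY by (metis disjoint_iff)
    show "{x ((h + int (Suc j div 2)) mod q), y ((h - int (j div 2)) mod q)} \<in> cross_edges X Y" for h j
      using xX yY by (auto simp: cross_edges_def)
    show "card (cross_edges X Y) = card {0..<q} * (2 * r - 1)"
      using card by (simp add: card_cross_edges[OF XY] q_def)
  qed (use r finite_cross_edges[OF fin] in auto)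
qed

text \<open>With vertices \<open>x\<close> of \<open>X\<close> indexed modulo \<open>|X|\<close>, the \<open>h\<close>-th path is
  \<open>x\<^sub>h, y\<^bsub>0,p\<^esub>, x\<^bsub>h+1\<^esub>, y\<^bsub>1,p\<^esub>, \<dots>, x\<^bsub>h+r-1\<^esub>, \<zeta> x\<^bsub>h+r-1\<^esub>\<close> with \<open>p = h mod 2\<close>: of the two
  candidates for a path through a given edge, only one has the right parity.\<close>

lemma path_decomposable_even_bipartite:
  assumes fin: "finite X" "finite Y" and XY: "X \<inter> Y = {}" and r: "r \<ge> 1"
    and card: "even (card X)" "card X \<ge> r" "card Y = 2 * r - 2"
    and \<zeta>: "\<And>x. x \<in> X \<Longrightarrow> \<zeta> x \<notin> X \<union> Y"
  shows "path_decomposable (2 * r) (cross_edges X Y \<union> (\<lambda>x. {x, \<zeta> x}) ` X)"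
proof -
  define c where "c = int (card X)"
  have c0: "c > 0" and even_c: "even c" and rc: "int r \<le> c" using r card by (auto simp: c_def)
  obtain x where x: "bij_betw x {0..<c} X" using ex_int_enumeration[OF fin(1)] c_def by metis
  obtain y where y: "bij_betw y {0..<2 * r - 2} Y" using ex_bij_betw_nat_finite[OF fin(2)] card by metis
  have x_eq: "x (i mod c) = x (j mod c) \<longleftrightarrow> i mod c = j mod c" for i j
    using inj_on_eq_iff[OF bij_betw_imp_inj_on[OF x], of "i mod c" "j mod c"] c0 by simp
  have lt: "\<bar>int i - int j\<bar> < c" if "i < r" "j < r" for i j using that rc by linarith
  have xX: "x (i mod c) \<in> X" for i using bij_betwE[OF x] c0 by simp
  define a where "a h j = x ((h + int j) mod c)" for h j
  \<comment> \<open>The vertices of \<open>Y\<close> are grouped in pairs; the parity of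
    \<open>h\<close> selects one member of the \<open>j\<close>-th pair.\<close>
  define s where "s h j = 2 * j + nat (h mod 2)" for h :: int and j :: nat
  define b where "b h j = (if j < r - 1 then y (s h j) else \<zeta> (a h j))" for h j
  have s: "s h j \<in> {0..<2 * r - 2}" if "j < r - 1" for h j
  proof -
    have "nat (h mod 2) < 2" by simp
    then show ?thesis using that by (simp add: s_def)
  qed
  have s_eq: "i = j \<and> h mod 2 = h' mod 2" if "s h i = s h' j" for h h' i j
  proof -
    have "nat (h mod 2) < 2" "nat (h' mod 2) < 2" by auto
    moreover have "i = j \<and> u = w" if "2 * i + u = 2 * j + w" "u < 2" "w < 2" for u w :: nat
      using that by presburger
    ultimately have "i = j \<and> nat (h mod 2) = nat (h' mod 2)" using that by (simp add: s_def)
    then show ?thesis by (simp add: eq_nat_nat_iff)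
  qed
  have y_eq: "i = j \<and> h mod 2 = h' mod 2" if "y (s h i) = y (s h' j)" "i < r - 1" "j < r - 1" for h h' i j
    using s_eq that inj_on_eq_iff[OF bij_betw_imp_inj_on[OF y] s s] by blast
  have yY: "y (s h j) \<in> Y" if "j < r - 1" for h j using bij_betwE[OF y] s[OF that] by blast
  have aX: "a h j \<in> X" for h j by (simp add: a_def xX)
  have bX: "b h j \<notin> X" for h j using yY XY \<zeta> aX by (auto simp: b_def)
  \<comment> \<open>Membership in \<open>Y\<close> tells the final vertex, given by
    \<open>\<zeta>\<close>, from the other \<open>b\<close>-vertices.\<close>
  have bY: "b h j \<in> Y \<longleftrightarrow> j < r - 1" for h j using yY \<zeta>[OF aX, of h j] by (auto simp: b_def)
  show ?thesis
  proof (rule path_decomposable_alternating[where I = "{0..<c}" and a = a and b = b])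
    have "cross_edges X Y \<inter> (\<lambda>x. {x, \<zeta> x}) ` X = {}"
      using XY \<zeta> by (fastforce simp: cross_edges_def doubleton_eq_iff)
    moreover have "inj_on (\<lambda>x. {x, \<zeta> x}) X"
      using \<zeta> by (fastforce simp: inj_on_def doubleton_eq_iff)
    ultimately have "card (cross_edges X Y \<union> (\<lambda>x. {x, \<zeta> x}) ` X) = card X * (2 * r - 2) + card X"
      using fin finite_cross_edges[OF fin] card
      by (simp add: card_Un_disjoint card_image card_cross_edges[OF XY])
    also have "\<dots> = card X * (2 * r - 2 + 1)" by simp
    also have "2 * r - 2 + 1 = 2 * r - 1" using r by simp
    finally show "card (cross_edges X Y \<union> (\<lambda>x. {x, \<zeta> x}) ` X) = card {0..<c} * (2 * r - 1)"
      by (simp add: c_def)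
  next
    fix h
    show "inj_on (a h) {..<r}"
      by (rule inj_onI) (use lt in \<open>fastforce simp: a_def x_eq dest: int_mod_eq_imp_eq\<close>)
    show "inj_on (b h) {..<r}"
    proof (rule inj_onI)
      fix i j assume ij: "i \<in> {..<r}" "j \<in> {..<r}" "b h i = b h j"
      have "i < r - 1 \<longleftrightarrow> j < r - 1" using bY[of h i] bY[of h j] ij(3) by simp
      show "i = j"
      proof (cases "i < r - 1")
        case True
        then have "y (s h i) = y (s h j)" using ij(3) \<open>i < r - 1 \<longleftrightarrow> j < r - 1\<close> by (simp add: b_def)
        then show ?thesis using y_eq True \<open>i < r - 1 \<longleftrightarrow> j < r - 1\<close> by blast
      next
        case False
        then show ?thesis using ij(1,2) \<open>i < r - 1 \<longleftrightarrow> j < r - 1\<close> by auto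
      qed
    qed
  next
    fix h j assume "j < 2 * r - 1"
    show "{a h (Suc j div 2), b h (j div 2)} \<in> cross_edges X Y \<union> (\<lambda>x. {x, \<zeta> x}) ` X"
    proof (cases "j div 2 < r - 1")
      case True
      then have "b h (j div 2) \<in> Y" using bY by blast
      then show ?thesis using aX by (auto simp: cross_edges_def)
    next
      case False
      then have "j = 2 * (r - 1)" using \<open>j < 2 * r - 1\<close> by presburger
      then have "Suc j div 2 = r - 1" "j div 2 = r - 1" by simp_all
      then show ?thesis using aX by (auto simp: b_def)
    qed
  next
    fix h h' j j'
    assume *: "h \<in> {0..<c}" "h' \<in> {0..<c}" "j < 2 * r - 1" "j' < 2 * r - 1"
      "a h (Suc j div 2) = a h' (Suc j' div 2)" "b h (j div 2) = b h' (j' div 2)"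
    have m: "(h + int (Suc j div 2)) mod c = (h' + int (Suc j' div 2)) mod c"
      using * x_eq by (simp add: a_def)
    have iff: "j div 2 < r - 1 \<longleftrightarrow> j' div 2 < r - 1"
      using bY[of h "j div 2"] bY[of h' "j' div 2"] *(6) by simp
    have "j = j'"
    proof (cases "j div 2 < r - 1")
      case True
      then have "y (s h (j div 2)) = y (s h' (j' div 2))" using iff *(6) by (simp add: b_def)
      then have d: "j div 2 = j' div 2 \<and> h mod 2 = h' mod 2" by (rule y_eq) (use True iff in blast)+
      \<comment> \<open>Here the parity of \<open>card X\<close> enters: as \<open>c\<close> is
        even, a congruence modulo \<open>c\<close> descends to one modulo 2. Since \<open>h\<close>
        and \<open>h'\<close> have equal parity, it compares the parities of \<open>j\<close> and
        \<open>j'\<close>.\<close>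
      have m2: "(h + int (Suc j div 2)) mod 2 = (h' + int (Suc j' div 2)) mod 2"
        using arg_cong[OF m, of "\<lambda>z. z mod 2"] by (simp only: mod_mod_cancel[OF even_c])
      have "(h + int (j div 2)) mod 2 = (h' + int (j' div 2)) mod 2" using d by (intro mod_add_cong) auto
      with m2 have "(h + int (Suc j div 2) - (h + int (j div 2))) mod 2
          = (h' + int (Suc j' div 2) - (h' + int (j' div 2))) mod 2"
        by (rule mod_diff_cong)
      moreover have "Suc i div 2 = i div 2 + i mod 2" for i :: nat by presburger
      ultimately have "int (j mod 2) mod 2 = int (j' mod 2) mod 2" by simp
      moreover have "j div 2 = j' div 2" using d by simp
      ultimately show ?thesis by presburger
    next
      case False
      then have "\<not> j' div 2 < r - 1" using iff by blast
      \<comment> \<open>Only the last edge, \<open>j = 2 * r - 2\<close>, leads outside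
        \<open>Y\<close>.\<close>
      with False show ?thesis using *(3,4) by presburger
    qed
    then have "(h + int (Suc j div 2) - int (Suc j div 2)) mod c
        = (h' + int (Suc j div 2) - int (Suc j div 2)) mod c"
      using m by (intro mod_diff_cong) auto
    then show "h = h'" using * by simp
  next
    show "a h i \<noteq> b h' j" for h h' i j using aX[of h i] bX[of h' j] by metis
  qed (use fin r finite_cross_edges[OF fin] in auto)
qed

section \<open>Hamiltonian zigzag paths of complete graphs\<close>

text \<open>Walecki's zigzag: modulo \<open>2 t\<close>, consecutive vertices of the \<open>i\<close>-th path have sum
  \<open>2 i + 1\<close> and \<open>2 i\<close> alternately, so that an edge determines its path.\<close>

lemma zigzag_paths:
  assumes fin: "finite S" and card: "card S = 2 * t" and t: "t \<ge> 1"
  shows "\<exists>p :: int \<Rightarrow> nat \<Rightarrow> 'a.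
    (\<forall>i\<in>{0..<int t}. inj_on (p i) {..<2 * t} \<and> p i ` {..<2 * t} \<subseteq> S) \<and>
    (\<forall>i\<in>{0..<int t}. \<forall>i'\<in>{0..<int t}. \<forall>j j'.
        {p i j, p i (Suc j)} = {p i' j', p i' (Suc j')} \<longrightarrow> i = i') \<and>
    inj_on (\<lambda>i. p i 0) {0..<int t} \<and> inj_on (\<lambda>i. p i (2 * t - 1)) {0..<int t} \<and>
    (\<forall>i\<in>{0..<int t}. \<forall>i'\<in>{0..<int t}. p i 0 \<noteq> p i' (2 * t - 1))"
proof -
  define c where "c = 2 * int t"
  have c0: "c > 0" using t by (simp add: c_def)
  obtain x where x: "bij_betw x {0..<c} S" using ex_int_enumeration[OF fin] card c_def
    by (metis of_nat_mult of_nat_numeral)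
  have x_eq: "x (i mod c) = x (j mod c) \<longleftrightarrow> i mod c = j mod c" for i j
    using inj_on_eq_iff[OF bij_betw_imp_inj_on[OF x], of "i mod c" "j mod c"] c0 by simp
  have xS: "x (i mod c) \<in> S" for i using bij_betwE[OF x] c0 by simp
  \<comment> \<open>The offsets are 0, 1, -1, 2, -2, ..., ending with \<open>t\<close> at position
    \<open>2 * t - 1\<close>; below \<open>2 * t\<close> they meet every residue modulo
    \<open>c\<close> once.\<close>
  define z where "z j = (if odd j then int (Suc j div 2) else - int (j div 2))" for j
  define p where "p i j = x ((i + z j) mod c)" for i j
  have z_sum: "z j + z (Suc j) = (if even j then 1 else 0)" for j
    by (cases "even j") (auto simp: z_def elim!: evenE oddE)
  have z_inj: "i = j" if "z i = z j" for i j
    using that by (auto simp: z_def split: if_splits; presburger)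
  have z_bound: "- int t < z j \<and> z j \<le> int t" if "j < 2 * t" for j
    using that by (auto simp: z_def)
  have inj: "inj_on (p i) {..<2 * t}" for i
  proof (rule inj_onI)
    fix j j' assume *: "j \<in> {..<2 * t}" "j' \<in> {..<2 * t}" "p i j = p i j'"
    then have "(i + z j) mod c = (i + z j') mod c" by (simp add: p_def x_eq)
    then have "i + z j = i + z j'"
      by (rule int_mod_eq_imp_eq) (use * z_bound[of j] z_bound[of j'] in \<open>auto simp: c_def\<close>)
    then show "j = j'" using z_inj by simp
  qed
  have unique: "i = i'" if i: "i \<in> {0..<int t}" "i' \<in> {0..<int t}"
    "{p i j, p i (Suc j)} = {p i' j', p i' (Suc j')}" for i i' j j'
  proof -
    \<comment> \<open>Adding the indices of both ends makes the orientation of the edge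
      irrelevant.\<close>
    have "(i + z j + (i + z (Suc j))) mod c = (i' + z j' + (i' + z (Suc j'))) mod c"
      using i(3) unfolding doubleton_eq_iff p_def x_eq
    proof
      assume "(i + z j) mod c = (i' + z j') mod c \<and> (i + z (Suc j)) mod c = (i' + z (Suc j')) mod c"
      then show ?thesis using mod_add_cong by blast
    next
      assume "(i + z j) mod c = (i' + z (Suc j')) mod c \<and> (i + z (Suc j)) mod c = (i' + z j') mod c"
      then have "(i + z j + (i + z (Suc j))) mod c = (i' + z (Suc j') + (i' + z j')) mod c"
        using mod_add_cong by blast
      then show ?thesis by (simp add: add.commute)
    qed
    then have "(2 * i + (if even j then 1 else 0)) mod c = (2 * i' + (if even j' then 1 else 0)) mod c"
      using z_sum[of j] z_sum[of j'] by (simp add: algebra_simps)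
    \<comment> \<open>Both sides lie between 0 and \<open>c - 1\<close>, so the congruence is an
      equality; parity then separates the summand 0 or 1 from \<open>2 * i\<close>.\<close>
    then have "2 * i + (if even j then 1 else 0) = 2 * i' + (if even j' then 1 else (0::int))"
      by (rule int_mod_eq_imp_eq) (use i in \<open>auto simp: c_def\<close>)
    then show "i = i'" by (simp split: if_splits; presburger)
  qed
  \<comment> \<open>The first vertices thus have indices \<open>0\<close> to \<open>t - 1\<close>
    and the last ones \<open>t\<close> to \<open>2 * t - 1\<close>: the ends of the paths exhaust
    \<open>S\<close>, each vertex being an end once.\<close>
  have z_last: "z (2 * t - 1) = int t" using t by (auto simp: z_def)
  have z_first: "z 0 = 0" by (simp add: z_def)
  show ?thesis
  proof (intro exI[of _ p] conjI ballI allI impI)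
    show "inj_on (\<lambda>i. p i 0) {0..<int t}"
    proof (rule inj_onI)
      fix i i' assume *: "i \<in> {0..<int t}" "i' \<in> {0..<int t}" "p i 0 = p i' 0"
      then have "(i + 0) mod c = (i' + 0) mod c" unfolding p_def x_eq z_first by blast
      then have "i + 0 = i' + 0" by (rule int_mod_eq_imp_eq) (use * in \<open>auto simp: c_def\<close>)
      then show "i = i'" by simp
    qed
    show "inj_on (\<lambda>i. p i (2 * t - 1)) {0..<int t}"
    proof (rule inj_onI)
      fix i i' assume *: "i \<in> {0..<int t}" "i' \<in> {0..<int t}" "p i (2 * t - 1) = p i' (2 * t - 1)"
      then have "(i + int t) mod c = (i' + int t) mod c" unfolding p_def x_eq z_last by blast
      then have "i + int t = i' + int t" by (rule int_mod_eq_imp_eq) (use * in \<open>auto simp: c_def\<close>)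
      then show "i = i'" by simp
    qed
    fix i i' assume *: "i \<in> {0..<int t}" "i' \<in> {0..<int t}"
    show "p i 0 \<noteq> p i' (2 * t - 1)"
    proof
      assume "p i 0 = p i' (2 * t - 1)"
      then have "i mod c = (i' + int t) mod c" unfolding p_def x_eq z_last z_first by simp
      then have "i = i' + int t" by (rule int_mod_eq_imp_eq) (use * in \<open>auto simp: c_def\<close>)
      then show False using * by simp
    qed
  next
    fix i i' j j' assume "i \<in> {0..<int t}" "i' \<in> {0..<int t}"
      "{p i j, p i (Suc j)} = {p i' j', p i' (Suc j')}"
    then show "i = i'" by (rule unique)
  qed (use inj in \<open>auto simp: p_def xS\<close>)
qed

lemma card_all_edges:
  assumes "finite S" "card S = 2 * t"
  shows "card (all_edges S) = t * (2 * t - 1)"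
  using assms by (simp add: n_subsets choose_two)

text \<open>The \<open>t\<close> zigzag paths with \<open>2 * t - 1\<close> edges each account for
  all \<open>t * (2 * t - 1)\<close> edges.\<close>

lemma path_decomposable_complete:
  assumes fin: "finite S" and card: "card S = 2 * t" and t: "t \<ge> 1"
  shows "path_decomposable (2 * t) (all_edges S)"
proof -
  obtain p :: "int \<Rightarrow> nat \<Rightarrow> 'a" where
    inj: "\<And>i. i \<in> {0..<int t} \<Longrightarrow> inj_on (p i) {..<2 * t}" and
    pS: "\<And>i. i \<in> {0..<int t} \<Longrightarrow> p i ` {..<2 * t} \<subseteq> S" and
    unique: "\<And>i i' j j'. i \<in> {0..<int t} \<Longrightarrow> i' \<in> {0..<int t} \<Longrightarrow>
        {p i j, p i (Suc j)} = {p i' j', p i' (Suc j')} \<Longrightarrow> i = i'"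
    using zigzag_paths[OF assms] by metis
  show ?thesis
  proof (rule path_decomposableI[where I = "{0..<int t}" and p = p])
    fix i j assume i: "i \<in> {0..<int t}" and j: "Suc j < 2 * t"
    have "p i j \<noteq> p i (Suc j)" using inj_on_eq_iff[OF inj[OF i], of j "Suc j"] j by simp
    then show "{p i j, p i (Suc j)} \<in> all_edges S" using pS[OF i] j by (auto simp: image_subset_iff)
  qed (use fin t card_all_edges[OF fin card] inj in \<open>auto intro: unique\<close>)
qed

text \<open>Each zigzag path is extended by \<open>v\<close> at its first and by \<open>v'\<close> at its last vertex;
  \<open>A\<close> is the set of the first vertices.\<close>

lemma path_decomposable_complete_extended:
  assumes fin: "finite S" and card: "card S = 2 * t" and t: "t \<ge> 1"
    and v: "v \<notin> S" "v' \<notin> S" "v \<noteq> v'"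
  shows "\<exists>A\<subseteq>S. path_decomposable (2 * t + 2)
      (all_edges S \<union> cross_edges A {v} \<union> cross_edges (S - A) {v'})"
proof -
  obtain p :: "int \<Rightarrow> nat \<Rightarrow> 'a" where
    inj: "\<And>i. i \<in> {0..<int t} \<Longrightarrow> inj_on (p i) {..<2 * t}" and
    pS: "\<And>i. i \<in> {0..<int t} \<Longrightarrow> p i ` {..<2 * t} \<subseteq> S" and
    unique: "\<And>i i' j j'. i \<in> {0..<int t} \<Longrightarrow> i' \<in> {0..<int t} \<Longrightarrow>
        {p i j, p i (Suc j)} = {p i' j', p i' (Suc j')} \<Longrightarrow> i = i'" and
    first: "inj_on (\<lambda>i. p i 0) {0..<int t}" and
    last: "inj_on (\<lambda>i. p i (2 * t - 1)) {0..<int t}" and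
    fl: "\<And>i i'. i \<in> {0..<int t} \<Longrightarrow> i' \<in> {0..<int t} \<Longrightarrow> p i 0 \<noteq> p i' (2 * t - 1)"
    using zigzag_paths[OF fin card t] by metis
  have pS': "p i j \<in> S" if "i \<in> {0..<int t}" "j < 2 * t" for i j using pS that by blast
  define A where "A = (\<lambda>i. p i 0) ` {0..<int t}"
  have AS: "A \<subseteq> S" using pS' t by (auto simp: A_def)
  have cA: "card A = t" using first by (simp add: A_def card_image)
  \<comment> \<open>By \<open>last\<close> and \<open>fl\<close>, these \<open>t\<close> vertices
    are exactly the last vertices of the zigzag paths.\<close>
  have cSA: "card (S - A) = t" using AS cA card fin by (simp add: card_Diff_subset finite_subset)
  let ?E = "all_edges S \<union> cross_edges A {v} \<union> cross_edges (S - A) {v'}"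
  define g where "g i j = (if j = 0 then v else if j \<le> 2 * t then p i (j - 1) else v')" for i j
  have gS: "g i j \<in> S" if "i \<in> {0..<int t}" "0 < j" "j \<le> 2 * t" for i j
    using pS' that by (simp add: g_def)
  have g0: "g i 0 = v" and gl: "g i (Suc (2 * t)) = v'" for i by (auto simp: g_def)
  have "path_decomposable (2 * t + 2) ?E"
  proof (rule path_decomposableI[where I = "{0..<int t}" and p = g])
    have "finite A" using AS fin finite_subset by blast
    then have "finite (cross_edges A {v})" "finite (cross_edges (S - A) {v'})"
      using fin by (auto intro: finite_cross_edges)
    moreover show "finite ?E" using calculation fin by simp
    moreover have "all_edges S \<inter> cross_edges A {v} = {}" using v by (intro all_edges_cross_disjoint) auto
    moreover have "(all_edges S \<union> cross_edges A {v}) \<inter> cross_edges (S - A) {v'} = {}"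
      using v AS by (auto simp: cross_edges_def doubleton_eq_iff)
    ultimately have "card ?E = card (all_edges S) + card (cross_edges A {v}) + card (cross_edges (S - A) {v'})"
      using fin by (simp add: card_Un_disjoint)
    also have "card (cross_edges A {v}) = t" using cA v AS by (subst card_cross_edges) auto
    also have "card (cross_edges (S - A) {v'}) = t" using cSA v AS by (subst card_cross_edges) auto
    also have "card (all_edges S) + t + t = t * (2 * t - 1 + 2)"
      unfolding card_all_edges[OF fin card] by (simp add: algebra_simps)
    also have "2 * t - 1 + 2 = 2 * t + 2 - 1" using t by simp
    finally show "card ?E = card {0..<int t} * (2 * t + 2 - 1)" by simp
  next
    fix i assume i: "i \<in> {0..<int t}"
    show "inj_on (g i) {..<2 * t + 2}"
    proof (rule inj_onI)
      fix j j' assume j: "j \<in> {..<2 * t + 2}" "j' \<in> {..<2 * t + 2}" and eq: "g i j = g i j'"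
      have cases: "j = 0 \<and> g i j = v \<or> j = Suc (2 * t) \<and> g i j = v' \<or>
          0 < j \<and> j \<le> 2 * t \<and> g i j \<in> S" if "j \<in> {..<2 * t + 2}" for j
        using that gS[OF i, of j] g0 gl
        by (cases "j = 0"; cases "j \<le> 2 * t") (auto dest: le_less_Suc_eq simp: g_def)
      have "j = j'" if "0 < j" "j \<le> 2 * t" "0 < j'" "j' \<le> 2 * t"
      proof -
        have "p i (j - 1) = p i (j' - 1)" using eq that by (simp add: g_def)
        then have "j - 1 = j' - 1" using inj_on_eq_iff[OF inj[OF i], of "j - 1" "j' - 1"] that by simp
        then show ?thesis using that by simp
      qed
      then show "j = j'" using cases[OF j(1)] cases[OF j(2)] eq v by metis
    qed
    fix j assume j: "Suc j < 2 * t + 2"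
    consider "j = 0" | "0 < j" "j < 2 * t" | "j = 2 * t" using j by linarith
    then show "{g i j, g i (Suc j)} \<in> ?E"
    proof cases
      case 1
      then have "{g i j, g i (Suc j)} = {p i 0, v}" using t by (auto simp: g_def)
      then show ?thesis using i by (auto simp: A_def cross_edges_def)
    next
      case 2
      then have "g i j \<noteq> g i (Suc j)" using inj_on_eq_iff[OF inj[OF i], of "j - 1" j] by (simp add: g_def)
      then show ?thesis using gS[OF i, of j] gS[OF i, of "Suc j"] 2 by auto
    next
      case 3
      then have "{g i j, g i (Suc j)} = {p i (2 * t - 1), v'}" using t by (auto simp: g_def)
      moreover have "p i (2 * t - 1) \<in> S - A" using pS'[OF i] t fl i by (fastforce simp: A_def)
      ultimately show ?thesis by (auto simp: cross_edges_def)
    qed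
  next
    fix i i' j j'
    assume i: "i \<in> {0..<int t}" "i' \<in> {0..<int t}" and j: "Suc j < 2 * t + 2" "Suc j' < 2 * t + 2"
      and eq: "{g i j, g i (Suc j)} = {g i' j', g i' (Suc j')}"
    \<comment> \<open>The vertices \<open>v\<close> and \<open>v'\<close> mark the first and the
      last edge of a path, so these are compared separately and all other edges lie in the original
      zigzag paths.\<close>
    have gv: "v \<in> {g i j, g i (Suc j)} \<longleftrightarrow> j = 0" "v' \<in> {g i j, g i (Suc j)} \<longleftrightarrow> j = 2 * t"
      if "i \<in> {0..<int t}" "Suc j < 2 * t + 2" for i j
      using that v t pS'[of i "j - 1"] pS'[of i j] by (auto simp: g_def)
    have jj: "j = 0 \<longleftrightarrow> j' = 0" "j = 2 * t \<longleftrightarrow> j' = 2 * t"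
      using gv[OF i(1) j(1)] gv[OF i(2) j(2)] eq by auto
    consider "j = 0" | "0 < j" "j < 2 * t" | "j = 2 * t" using j by linarith
    then show "i = i'"
    proof cases
      case 1
      then have "p i 0 = p i' 0" using jj eq t by (auto simp: g_def doubleton_eq_iff)
      then show ?thesis using first i by (auto simp: inj_on_def)
    next
      case 2
      then have j': "0 < j'" "j' < 2 * t" using jj j by auto
      have "{p i (j - 1), p i (Suc (j - 1))} = {p i' (j' - 1), p i' (Suc (j' - 1))}"
        using eq 2 j' by (simp add: g_def)
      then show ?thesis using unique i by blast
    next
      case 3
      then have "p i (2 * t - 1) = p i' (2 * t - 1)" using jj eq t by (auto simp: g_def doubleton_eq_iff)
      then show ?thesis using last i by (auto simp: inj_on_def)
    qed
  qed (use t in auto)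
  then show ?thesis using AS by blast
qed

section \<open>Joining new vertices to the old ones\<close>

text \<open>\<open>Y\<close> is cut into \<open>a\<close> blocks of \<open>q\<close> vertices, and
  the cross edges from \<open>X\<close> to different blocks are disjoint.\<close>

lemma path_decomposable_cross_blocks:
  assumes "finite X" "finite Y" "X \<inter> Y = {}" "card Y = a * q"
    and block: "\<And>Y. finite Y \<Longrightarrow> X \<inter> Y = {} \<Longrightarrow> card Y = q \<Longrightarrow> path_decomposable k (cross_edges X Y)"
  shows "path_decomposable k (cross_edges X Y)"
  using assms(2-4)
proof (induction a arbitrary: Y)
  case 0
  then show ?case by (simp add: cross_edges_def path_decomposable_empty)
next
  case (Suc a)
  then obtain Z where Z: "Z \<subseteq> Y" "card Z = q" "finite Z"
    by (metis le_add1 mult_Suc obtain_subset_with_card_n)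
  have "path_decomposable k (cross_edges X (Z \<union> (Y - Z)))"
    unfolding cross_edges_Un
  proof (intro path_decomposable_Un)
    show "path_decomposable k (cross_edges X Z)" using Z Suc.prems by (intro block) auto
    show "path_decomposable k (cross_edges X (Y - Z))"
      by (rule Suc.IH) (use Z Suc.prems in \<open>auto simp: card_Diff_subset\<close>)
    show "cross_edges X Z \<inter> cross_edges X (Y - Z) = {}"
      using Z Suc.prems by (intro cross_edges_disjoint) auto
  qed
  moreover have "Z \<union> (Y - Z) = Y" using Z by blast
  ultimately show ?case by simp
qed

text \<open>One vertex \<open>z\<close> of \<open>Y\<close> is set aside and serves as the common
  last vertex of all paths, that is, \<open>\<zeta>\<close> is constant.\<close>

lemma path_decomposable_even_bipartite_full:
  assumes fin: "finite X" "finite Y" and XY: "X \<inter> Y = {}" and r: "r \<ge> 1"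
    and card: "even (card X)" "card X \<ge> r" "card Y = 2 * r - 1"
  shows "path_decomposable (2 * r) (cross_edges X Y)"
proof -
  have "Y \<noteq> {}" using card r by auto
  then obtain z where z: "z \<in> Y" by blast
  have "path_decomposable (2 * r) (cross_edges X (Y - {z}) \<union> (\<lambda>x. {x, z}) ` X)"
    by (rule path_decomposable_even_bipartite) (use assms z in auto)
  also have "cross_edges X (Y - {z}) \<union> (\<lambda>x. {x, z}) ` X = cross_edges X Y"
    using z by (auto simp: cross_edges_def)
  finally show ?thesis .
qed

text \<open>Absorbing one old vertex \<open>v\<close> makes \<open>S \<union> {v}\<close> large
  enough for Hamiltonian paths with \<open>2 * r\<close> vertices. Outside \<open>v\<close> there
  remain full blocks of \<open>2 * r - 1\<close> old vertices or, in the other case, full blocks and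
  one block that lacks a vertex.\<close>

lemma path_decomposable_join_odd:
  assumes fin: "finite S" "finite V" and SV: "S \<inter> V = {}" and r: "r \<ge> 1" and a: "a \<ge> 1"
    and card: "card S = 2 * r - 1" "card V = a * (2 * r - 1) \<or> card V = a * (2 * r - 1) + 1"
  shows "path_decomposable (2 * r) (all_edges S \<union> cross_edges S V)"
proof -
  have "card V > 0" using card(2) a r by auto
  then obtain v where v: "v \<in> V" by fastforce
  have cV: "card (V - {v}) = card V - 1" using v by simp
  have blocks: "path_decomposable (2 * r) (cross_edges S Y)"
    if "finite Y" "S \<inter> Y = {}" "card Y = b * (2 * r - 1)" for Y b
    using path_decomposable_cross_blocks[OF fin(1) that] path_decomposable_balanced_bipartite
      fin(1) r card(1) by blast
  have "path_decomposable (2 * r) (cross_edges S (V - {v}))"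
    using card(2)
  proof
    assume "card V = a * (2 * r - 1) + 1"
    then show ?thesis using fin SV cV by (intro blocks[where b = a]) auto
  next
    assume *: "card V = a * (2 * r - 1)"
    obtain b where b: "a = Suc b" using a by (cases a) auto
    have cV': "card (V - {v}) = (2 * r - 2) + b * (2 * r - 1)" using * cV r by (simp add: b)
    then obtain Z where Z: "Z \<subseteq> V - {v}" "card Z = 2 * r - 2" "finite Z"
      by (metis le_add1 obtain_subset_with_card_n)
    have "path_decomposable (2 * r) (cross_edges S (Z \<union> (V - {v} - Z)))"
      unfolding cross_edges_Un
    proof (intro path_decomposable_Un)
      show "path_decomposable (2 * r) (cross_edges S Z)"
      \<comment> \<open>For \<open>r = 1\<close> the short block \<open>Z\<close> is empty.
        Otherwise \<open>Z\<close> takes the role of the even side, with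
        \<open>2 * r - 2 \<ge> r\<close>, and \<open>S\<close> that of the side with
        \<open>2 * r - 1\<close> vertices.\<close>
      proof (cases "r = 1")
        case True
        then show ?thesis using Z by (simp add: cross_edges_def path_decomposable_empty)
      next
        case False
        then show ?thesis unfolding cross_edges_commute[of S]
          using Z SV fin r card(1) by (intro path_decomposable_even_bipartite_full) auto
      qed
      show "path_decomposable (2 * r) (cross_edges S (V - {v} - Z))"
        by (rule blocks[where b = b]) (use Z fin SV cV' in \<open>auto simp: card_Diff_subset\<close>)
      show "cross_edges S Z \<inter> cross_edges S (V - {v} - Z) = {}"
        using Z SV by (intro cross_edges_disjoint) auto
    qed
    moreover have "Z \<union> (V - {v} - Z) = V - {v}" using Z by blast
    ultimately show ?thesis by simp
  qed
  moreover have "path_decomposable (2 * r) (all_edges (S \<union> {v}))"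
    by (rule path_decomposable_complete) (use v SV fin card(1) r in \<open>auto simp: card_insert_if\<close>)
  moreover have "all_edges (S \<union> {v}) \<inter> cross_edges S (V - {v}) = {}"
    using SV by (intro all_edges_cross_disjoint) auto
  ultimately have "path_decomposable (2 * r) (all_edges (S \<union> {v}) \<union> cross_edges S (V - {v}))"
    by (intro path_decomposable_Un)
  also have "all_edges (S \<union> {v}) \<union> cross_edges S (V - {v})
      = all_edges S \<union> cross_edges S ({v} \<union> (V - {v}))"
  proof -
    have "S \<inter> {v} = {}" using v SV by blast
    then show ?thesis unfolding all_edges_Un[OF \<open>S \<inter> {v} = {}\<close>] all_edges_singleton cross_edges_Un by blast
  qed
  also have "{v} \<union> (V - {v}) = V" using v by blast
  finally show ?thesis .
qed

text \<open>As \<open>card S\<close> is even and equal to the number of vertices of a path,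
  \<open>S\<close> has its own Hamiltonian decomposition and also serves as the even side towards
  each block of \<open>V\<close>.\<close>

lemma path_decomposable_join_succ:
  assumes fin: "finite S" "finite V" and SV: "S \<inter> V = {}" and r: "r \<ge> 1"
    and card: "card S = 2 * r" "card V = a * (2 * r - 1)"
  shows "path_decomposable (2 * r) (all_edges S \<union> cross_edges S V)"
proof (rule path_decomposable_Un)
  show "path_decomposable (2 * r) (all_edges S)" using fin card r by (intro path_decomposable_complete)
  have "path_decomposable (2 * r) (cross_edges S Y)"
    if "finite Y" "S \<inter> Y = {}" "card Y = 2 * r - 1" for Y
    using that fin card r by (intro path_decomposable_even_bipartite_full) auto
  then show "path_decomposable (2 * r) (cross_edges S V)"
    using path_decomposable_cross_blocks[OF fin SV card(2)] by blast
  show "all_edges S \<inter> cross_edges S V = {}" using SV by (rule all_edges_cross_disjoint)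
qed

text \<open>Each zigzag path of \<open>S\<close> is prolonged by \<open>v\<close> and \<open>v'\<close>. The edges left over at \<open>v\<close> and \<open>v'\<close>
  behave like those at a single vertex split in two, which is harmless as long as that vertex
  occurs only as an end of paths; hence the \<open>\<zeta>\<close> in the bipartite lemma.\<close>

lemma path_decomposable_join_pred:
  assumes fin: "finite S" "finite V" and SV: "S \<inter> V = {}" and r: "r \<ge> 2" and a: "a \<ge> 1"
    and card: "card S = 2 * r - 2" "card V = a * (2 * r - 1) + 1"
  shows "path_decomposable (2 * r) (all_edges S \<union> cross_edges S V)"
proof -
  obtain b where b: "a = Suc b" using a by (cases a) auto
  \<comment> \<open>The old vertices are split into \<open>v\<close>, \<open>v'\<close>, a set
    \<open>N\<close> of \<open>2 * r - 2\<close>, and a rest \<open>M\<close> consisting of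
    \<open>b\<close> full blocks.\<close>
  have cV: "card V = 2 + ((2 * r - 2) + b * (2 * r - 1))" using card(2) r by (simp add: b)
  then obtain T where "T \<subseteq> V" "card T = 2" by (metis le_add1 obtain_subset_with_card_n)
  then obtain v v' where v: "v \<in> V" "v' \<in> V" "v \<noteq> v'" by (auto simp: card_2_iff)
  have cV': "card (V - {v, v'}) = (2 * r - 2) + b * (2 * r - 1)" using v cV by (simp add: card_Diff_subset)
  then obtain N where N: "N \<subseteq> V - {v, v'}" "card N = 2 * r - 2" "finite N"
    by (metis le_add1 obtain_subset_with_card_n)
  define M where "M = V - {v, v'} - N"
  have cM: "card M = b * (2 * r - 1)" using N cV' fin by (simp add: M_def card_Diff_subset)
  have V: "V = {v, v'} \<union> N \<union> M" using v N by (auto simp: M_def)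
  have eq: "2 * (r - 1) + 2 = 2 * r" using r by simp
  have "\<exists>A\<subseteq>S. path_decomposable (2 * (r - 1) + 2)
      (all_edges S \<union> cross_edges A {v} \<union> cross_edges (S - A) {v'})"
    by (rule path_decomposable_complete_extended) (use fin SV card(1) r v in auto)
  then obtain A where A: "A \<subseteq> S"
    and AE: "path_decomposable (2 * r) (all_edges S \<union> cross_edges A {v} \<union> cross_edges (S - A) {v'})"
    unfolding eq by blast
  \<comment> \<open>The prolonged zigzag paths use one of the edges from \<open>x\<close> to
    \<open>v\<close> and \<open>v'\<close>; \<open>\<zeta> x\<close> is the end of the other
    one.\<close>
  define \<zeta> where "\<zeta> x = (if x \<in> A then v' else v)" for x
  let ?E = "all_edges S \<union> cross_edges A {v} \<union> cross_edges (S - A) {v'}"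
  let ?F = "cross_edges S N \<union> (\<lambda>x. {x, \<zeta> x}) ` S"
  have F: "path_decomposable (2 * r) ?F"
    by (rule path_decomposable_even_bipartite) (use fin SV card(1) r v N in \<open>auto simp: \<zeta>_def\<close>)
  have "path_decomposable (2 * r) (cross_edges S Y)"
    if "finite Y" "S \<inter> Y = {}" "card Y = 2 * r - 1" for Y
    using that fin card(1) r by (intro path_decomposable_even_bipartite_full) auto
  then have G: "path_decomposable (2 * r) (cross_edges S M)"
    using path_decomposable_cross_blocks[OF fin(1) _ _ cM] fin(2) SV by (auto simp: M_def)
  have "S \<inter> N = {}" "S \<inter> M = {}" "S \<inter> {v, v'} = {}" using SV V by auto
  have "?E \<inter> ?F = {}"
    using \<open>S \<inter> N = {}\<close> \<open>S \<inter> {v, v'} = {}\<close> N A v(3)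
    by (auto simp: cross_edges_def \<zeta>_def doubleton_eq_iff split: if_splits)
  moreover have "(?E \<union> ?F) \<inter> cross_edges S M = {}"
    using \<open>S \<inter> N = {}\<close> \<open>S \<inter> M = {}\<close> \<open>S \<inter> {v, v'} = {}\<close> A
    by (auto simp: cross_edges_def \<zeta>_def M_def doubleton_eq_iff split: if_splits)
  ultimately have "path_decomposable (2 * r) (?E \<union> ?F \<union> cross_edges S M)"
    by (rule path_decomposable_Un[OF path_decomposable_Un[OF AE F] G])
  also have "?E \<union> ?F \<union> cross_edges S M = all_edges S \<union> cross_edges S V"
  proof -
    have "cross_edges A {v} \<union> cross_edges (S - A) {v'} \<union> (\<lambda>x. {x, \<zeta> x}) ` S = cross_edges S {v, v'}"
    proof -
      have "(\<lambda>x. {x, \<zeta> x}) ` A = cross_edges A {v'}" "(\<lambda>x. {x, \<zeta> x}) ` (S - A) = cross_edges (S - A) {v}"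
        by (auto simp: \<zeta>_def cross_edges_singleton)
      moreover have "S = A \<union> (S - A)" using A by blast
      then have "(\<lambda>x. {x, \<zeta> x}) ` S = (\<lambda>x. {x, \<zeta> x}) ` A \<union> (\<lambda>x. {x, \<zeta> x}) ` (S - A)"
        using image_Un[of "\<lambda>x. {x, \<zeta> x}" A "S - A"] by simp
      ultimately have "(\<lambda>x. {x, \<zeta> x}) ` S = cross_edges A {v'} \<union> cross_edges (S - A) {v}" by simp
      moreover have "cross_edges S {v, v'} = cross_edges S {v} \<union> cross_edges S {v'}"
        using cross_edges_Un[of S "{v}" "{v'}"] by (simp add: insert_commute)
      ultimately show ?thesis using A by (auto simp: cross_edges_singleton)
    qed
    then show ?thesis unfolding V cross_edges_Un by blast
  qed
  finally show ?thesis .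
qed

section \<open>From path decompositions to designs\<close>

lemma card_path_edge:
  assumes "inj_on p {..<k}" "e \<in> path_edges k p"
  shows "card e = 2"
proof -
  obtain j where "j < k - 1" and e: "e = {p j, p (Suc j)}" using assms(2) by (auto simp: path_edges_def)
  then have "p j \<noteq> p (Suc j)" using inj_on_eq_iff[OF assms(1), of j "Suc j"] by simp
  then show ?thesis using e by simp
qed

text \<open>The isomorphism sends each vertex to its position on the path.\<close>

lemma graph_iso_path_graph:
  assumes p: "inj_on p {..<k}"
  shows "graph_iso (SGraph (p ` {..<k}) (path_edges k p)) (path_graph k)"
proof -
  define f where "f = the_inv_into {..<k} p"
  have f: "f (p i) = i" if "i < k" for i using the_inv_into_f_f[OF p] that by (simp add: f_def)
  have "bij_betw f (p ` {..<k}) {..<k}"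
    unfolding f_def using p by (intro bij_betw_the_inv_into inj_on_imp_bij_betw)
  moreover have "{p i, p j} \<in> path_edges k p \<longleftrightarrow> {i, j} \<in> {{i, Suc i} |i. Suc i < k}"
    if ij: "i < k" "j < k" for i j
  proof -
    have eq: "p a = p b \<longleftrightarrow> a = b" if "a < k" "b < k" for a b
      using inj_on_eq_iff[OF p] that by simp
    have "{p i, p j} = {p l, p (Suc l)} \<longleftrightarrow> {i, j} = {l, Suc l}" if "Suc l < k" for l
      using that ij by (auto simp: doubleton_eq_iff eq)
    then show ?thesis by (fastforce simp: path_edges_def image_iff)
  qed
  ultimately show ?thesis
    unfolding graph_iso_def by (intro exI[of _ f]) (auto simp: path_graph_def f)
qed

text \<open>The edges within \<open>S\<close> and between \<open>S\<close> and \<open>V\<close> are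
  those of the larger complete graph that the old blocks leave uncovered. Old and new blocks differ
  because their edge sets are nonempty and disjoint.\<close>

lemma path_design_extend:
  assumes D: "path_design k n V \<B>" and k: "k \<ge> 2" and S: "finite S" "S \<inter> V = {}"
    and E: "path_decomposable k (all_edges S \<union> cross_edges S V)"
  shows "\<exists>\<B>'. path_design k (n + card S) (V \<union> S) \<B>' \<and> \<B> \<subseteq> \<B>'"
proof -
  have V: "finite V" "card V = n" and iso: "iso_to_subgraph (path_graph k) (complete_graph V)"
    and blocks: "\<And>H. H \<in> \<B> \<Longrightarrow> is_subgraph H (complete_graph V) \<and> graph_iso H (path_graph k)"
    and inj: "inj_on edges \<B>" and part: "partition_on (all_edges V) (edges ` \<B>)"
    using D by (auto simp: path_design_def graph_design_def complete_graph_def)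
  obtain P where P: "\<And>p. p \<in> P \<Longrightarrow> inj_on p {..<k}"
    "all_edges S \<union> cross_edges S V = (\<Union>p\<in>P. path_edges k p)"
    "\<And>p p'. p \<in> P \<Longrightarrow> p' \<in> P \<Longrightarrow> p \<noteq> p' \<Longrightarrow> path_edges k p \<inter> path_edges k p' = {}"
    using E unfolding path_decomposable_def by metis
  define block where "block p = SGraph (p ` {..<k}) (path_edges k p)" for p :: "nat \<Rightarrow> 'a"
  have edges_block: "edges (block p) = path_edges k p" for p by (simp add: block_def)
  have ne: "path_edges k p \<noteq> {}" for p :: "nat \<Rightarrow> 'a" using k by (simp add: path_edges_def lessThan_empty_iff)
  have W: "all_edges (V \<union> S) = all_edges V \<union> (\<Union>p\<in>P. path_edges k p)"
    using all_edges_Un[of V S] S(2) P(2) cross_edges_commute[of V S] by (simp add: Int_commute Un_assoc)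
  have new: "all_edges V \<inter> (\<Union>p\<in>P. path_edges k p) = {}"
    unfolding P(2)[symmetric] using S(2) by (auto simp: cross_edges_def card_2_iff)
  have old: "edges H \<subseteq> all_edges V" if "H \<in> \<B>" for H
    using part that by (auto simp: partition_on_def)
  have old_ne: "edges H \<noteq> {}" if "H \<in> \<B>" for H
    using part that by (auto simp: partition_on_def)
  have old_new: "edges H \<inter> path_edges k p = {}" if "H \<in> \<B>" "p \<in> P" for H p
    using old[OF that(1)] new that(2) by blast
  let ?B = "\<B> \<union> block ` P"
  have mono: "is_subgraph H (complete_graph (V \<union> S))" if "is_subgraph H (complete_graph V)" for H
    using that by (auto simp: is_subgraph_def simple_graph_def complete_graph_def)
  have "is_subgraph (block p) (complete_graph (V \<union> S))" if p: "p \<in> P" for p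
  proof -
    have sub: "path_edges k p \<subseteq> all_edges (V \<union> S)" using W p by blast
    have "p i \<in> V \<union> S" if "i < k" for i
    proof -
      \<comment> \<open>The decomposition speaks of edges only, so vertices are located through an
        incident edge; for the last vertex this is the edge at position
        \<open>i - 1\<close>.\<close>
      have "p i \<in> \<Union> (path_edges k p)"
      proof (cases "Suc i < k")
        case True
        then show ?thesis by (auto simp: path_edges_def)
      next
        case False
        then show ?thesis using that k by (auto simp: path_edges_def intro!: bexI[of _ "i - 1"])
      qed
      then show ?thesis using sub by blast
    qed
    moreover have "e \<subseteq> p ` {..<k}" if "e \<in> path_edges k p" for e
      using that by (auto simp: path_edges_def)
    ultimately show ?thesis using sub card_path_edge[OF P(1)[OF p]]
      by (auto simp: is_subgraph_def simple_graph_def complete_graph_def block_def)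
  qed
  moreover have "graph_iso (block p) (path_graph k)" if "p \<in> P" for p
    unfolding block_def using P(1)[OF that] by (rule graph_iso_path_graph)
  ultimately have "\<forall>H\<in>?B. is_subgraph H (complete_graph (V \<union> S)) \<and> graph_iso H (path_graph k)"
    using blocks mono by blast
  moreover have "iso_to_subgraph (path_graph k) (complete_graph (V \<union> S))"
    using iso mono unfolding iso_to_subgraph_def by blast
  moreover have "inj_on edges ?B"
    unfolding inj_on_Un
  proof (intro conjI inj)
    show "inj_on edges (block ` P)"
    proof (rule inj_onI)
      fix H H' assume "H \<in> block ` P" "H' \<in> block ` P" and eq: "edges H = edges H'"
      then obtain p p' where p: "p \<in> P" "H = block p" "p' \<in> P" "H' = block p'" by blast
      then have "path_edges k p \<inter> path_edges k p' \<noteq> {}" using eq ne[of p] by (simp add: edges_block)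
      then show "H = H'" using P(3) p by blast
    qed
    show "edges ` (\<B> - block ` P) \<inter> edges ` (block ` P - \<B>) = {}"
    proof -
      have "edges H \<noteq> edges (block p)" if "H \<in> \<B>" "p \<in> P" for H p
        using old_new[OF that] ne[of p] by (auto simp: edges_block)
      then show ?thesis by blast
    qed
  qed
  moreover have "partition_on (all_edges (V \<union> S)) (edges ` ?B)"
  proof (rule partition_onI)
    show "\<Union> (edges ` ?B) = all_edges (V \<union> S)"
      using part unfolding W by (auto simp: partition_on_def edges_block)
    show "disjnt e e'" if e: "e \<in> edges ` ?B" "e' \<in> edges ` ?B" "e \<noteq> e'" for e e'
    proof -
      consider "e \<in> edges ` \<B>" "e' \<in> edges ` \<B>"
        | H p where "H \<in> \<B>" "p \<in> P" "e = edges H" "e' = path_edges k p"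
        | H p where "H \<in> \<B>" "p \<in> P" "e' = edges H" "e = path_edges k p"
        | p p' where "p \<in> P" "p' \<in> P" "e = path_edges k p" "e' = path_edges k p'"
        using e(1,2) edges_block by (auto simp: image_Un)
      then show ?thesis
      proof cases
        case 1
        moreover have "disjoint (edges ` \<B>)" using part by (simp add: partition_on_def)
        ultimately have "e \<inter> e' = {}" using e(3) by (intro disjointD)
        then show ?thesis by (simp add: disjnt_def)
      next
        case 4
        then show ?thesis using P(3) e(3) by (metis disjnt_def)
      qed (use old_new in \<open>auto simp: disjnt_def\<close>)
    qed
    have "edges H \<noteq> {}" if "H \<in> ?B" for H
      using that old_ne ne by (auto simp: edges_block)
    then show "{} \<notin> edges ` ?B" by blast
  qed
  moreover have "card (V \<union> S) = n + card S" using V S by (subst card_Un_disjoint) auto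
  ultimately have "path_design k (n + card S) (V \<union> S) ?B"
    using V S by (simp add: path_design_def graph_design_def complete_graph_def)
  then show ?thesis by blast
qed

section \<open>Growing a design to a prescribed order\<close>

text \<open>The infinite type supplies \<open>s\<close> points outside the finite set
  \<open>V\<close>. Which points these are is unspecified, so \<open>E\<close> covers every
  admissible \<open>S\<close>.\<close>

lemma path_design_grow:
  fixes V :: "'a::infinite set"
  assumes D: "path_design k n V \<B>" and k: "k \<ge> 2"
    and E: "\<And>S. finite S \<Longrightarrow> S \<inter> V = {} \<Longrightarrow> card S = s \<Longrightarrow>
        path_decomposable k (all_edges S \<union> cross_edges S V)"
  shows "\<exists>W \<B>'. path_design k (n + s) W \<B>' \<and> design_embedded V \<B> W \<B>'"
proof -
  have "finite V" using D by (simp add: path_design_def)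
  then have "infinite (UNIV - V)" using infinite_UNIV by (metis finite_Diff2)
  then obtain S where S: "finite S" "card S = s" "S \<subseteq> UNIV - V"
    using infinite_arbitrarily_large by blast
  then have "S \<inter> V = {}" by blast
  then obtain \<B>' where "path_design k (n + s) (V \<union> S) \<B>'" "\<B> \<subseteq> \<B>'"
    using path_design_extend[OF D k S(1)] E S by blast
  then show ?thesis unfolding design_embedded_def by blast
qed

lemma design_embedded_trans:
  "design_embedded V \<B> W \<C> \<Longrightarrow> design_embedded W \<C> X \<D> \<Longrightarrow> design_embedded V \<B> X \<D>"
  by (auto simp: design_embedded_def)

text \<open>Adding \<open>2 * r - 1\<close> points preserves the shape of the order, with
  \<open>a + c\<close> for \<open>a\<close>, so the same step can be repeated.\<close>

lemma path_design_grow_multiple: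
  fixes V :: "'a::infinite set"
  assumes D: "path_design (2 * r) n V \<B>" and r: "r \<ge> 1" and a: "a \<ge> 1"
    and n: "n = a * (2 * r - 1) \<or> n = a * (2 * r - 1) + 1"
  shows "\<exists>W \<B>'. path_design (2 * r) (n + c * (2 * r - 1)) W \<B>' \<and> design_embedded V \<B> W \<B>'"
proof (induction c)
  case 0
  show ?case using D by (auto simp: design_embedded_def)
next
  case (Suc c)
  then obtain W \<C> where W: "path_design (2 * r) (n + c * (2 * r - 1)) W \<C>" "design_embedded V \<B> W \<C>"
    by blast
  then have "finite W" and "card W = n + c * (2 * r - 1)" by (auto simp: path_design_def)
  then have cW: "card W = (a + c) * (2 * r - 1) \<or> card W = (a + c) * (2 * r - 1) + 1"
    using n by (auto simp: add_mult_distrib)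
  have "\<exists>X \<D>. path_design (2 * r) (n + c * (2 * r - 1) + (2 * r - 1)) X \<D> \<and> design_embedded W \<C> X \<D>"
    using W(1)
  proof (rule path_design_grow)
    fix S :: "'a set" assume "finite S" "S \<inter> W = {}" "card S = 2 * r - 1"
    then show "path_decomposable (2 * r) (all_edges S \<union> cross_edges S W)"
      using \<open>finite W\<close> cW r a by (intro path_decomposable_join_odd[where a = "a + c"]) auto
  qed (use r in simp)
  then show ?case using W(2) design_embedded_trans by (metis add.assoc add.commute mult_Suc)
qed

text \<open>A design includes the condition that the path fits into the complete graph, even if
  there are no blocks. This excludes the orders 0 and 1 and later yields
  \<open>a \<ge> 1\<close>.\<close>

lemma path_design_order_ge:
  assumes "path_design k n V \<B>"
  shows "k \<le> n"
proof -
  obtain H f where H: "verts H \<subseteq> V" "bij_betw f (verts H) {..<k}" and V: "finite V" "card V = n"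
    using assms by (auto simp: path_design_def graph_design_def iso_to_subgraph_def is_subgraph_def
        graph_iso_def path_graph_def complete_graph_def)
  then show ?thesis using bij_betw_same_card[OF H(2)] card_mono[OF V(1) H(1)] by simp
qed

theorem theorem3p3:
  fixes k n m :: nat
    and V :: "'a::infinite set"
    and \<B> :: "'a sgraph set"
  assumes "even k" and "k \<ge> 2"
    and "[n = 0] (mod (k - 1)) \<or> [n = 1] (mod (k - 1))"
    and "path_design k n V \<B>"
    and "m > n + 1"
    and "[m = 0] (mod (k - 1)) \<or> [m = 1] (mod (k - 1))"
  shows "\<exists>W \<B>'. path_design k m W \<B>' \<and> design_embedded V \<B> W \<B>'"
proof -
  obtain r where k: "k = 2 * r" using assms(1) by (elim evenE)
  then have r: "r \<ge> 1" using assms(2) by simp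
  define q where "q = 2 * r - 1"
  have kq: "k - 1 = q" and q1: "q \<ge> 1" using k r by (auto simp: q_def)
  have order: "\<exists>a. l = a * q \<or> l = a * q + 1" if "[l = 0] (mod q) \<or> [l = 1] (mod q)" "l \<ge> 1" for l
  proof -
    have "q dvd l \<or> q dvd l - 1" using that cong_to_1_nat by (auto simp: cong_0_iff)
    then show ?thesis
    proof
      assume "q dvd l - 1"
      then obtain a where "l - 1 = q * a" ..
      then have "l = a * q + 1" using that(2) by (simp add: mult.commute)
      then show ?thesis by blast
    qed (auto simp: dvd_def mult.commute)
  qed
  have n: "n \<ge> q + 1" using path_design_order_ge[OF assms(4)] k r by (simp add: q_def)
  obtain a where a: "n = a * q \<or> n = a * q + 1" using order[of n] assms(3) n kq by auto
  obtain b where b: "m = b * q \<or> m = b * q + 1" using order[of m] assms(5,6) kq by auto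
  have a1: "a \<ge> 1" using a n q1 by (cases a) auto
  have D: "path_design (2 * r) n V \<B>" using assms(4) k by simp
  note multiple = path_design_grow_multiple[OF D r a1 a[unfolded q_def]]
  have ab: "a * q \<le> b * q" using a b assms(5) by linarith
  then have "a \<le> b" using q1 by simp
  \<comment> \<open>Steps of \<open>q\<close> points keep the residue. If the residue must change,
    this is left to a single last step of \<open>q + 1\<close> or \<open>q - 1\<close>
    points.\<close>
  consider (same) c where "m = n + c * q"
    | (succ) "n = a * q" "m = b * q + 1" "a < b"
    | (pred) "n = a * q + 1" "m = b * q" "a < b" "r \<ge> 2"
  proof (cases "r = 1")
    case True
    \<comment> \<open>Here \<open>q = 1\<close>, and every difference of orders is a multiple of
      \<open>q\<close>.\<close>
    then show ?thesis using same[of "m - n"] assms(5) by (simp add: q_def)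
  next
    case False
    have split: "b * q = a * q + (b - a) * q" using \<open>a \<le> b\<close> by (simp flip: add_mult_distrib)
    have r2: "r \<ge> 2" using False r by simp
    \<comment> \<open>For \<open>a = b\<close> the orders would differ by exactly one, which
      \<open>m > n + 1\<close> excludes.\<close>
    have lt: "a < b" if "n = a * q \<and> m = b * q + 1 \<or> n = a * q + 1 \<and> m = b * q"
      using that assms(5) \<open>a \<le> b\<close> by (cases "a = b") auto
    consider "m = n + (b - a) * q" | "n = a * q" "m = b * q + 1" | "n = a * q + 1" "m = b * q"
      using a b split by linarith
    then show ?thesis
    proof cases
      case 1
      then show ?thesis by (rule same)
    next
      case 2
      then show ?thesis using lt succ by blast
    next
      case 3
      then show ?thesis using lt r2 pred by blast
    qed
  qed
  then show ?thesis
  proof cases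
    case same
    then show ?thesis using multiple[of c] by (simp add: k q_def)
  next
    case succ
    \<comment> \<open>After \<open>c = b - a - 1\<close> steps of \<open>q\<close> points, the last
      step adds \<open>2 * r = q + 1\<close> points.\<close>
    obtain c where c: "b = a + c + 1" using succ(3) by (metis add.assoc add.commute less_natE Suc_eq_plus1)
    obtain W \<C> where W: "path_design (2 * r) (n + c * q) W \<C>" "design_embedded V \<B> W \<C>"
      using multiple[of c] q_def by blast
    then have cW: "finite W" "card W = (a + c) * (2 * r - 1)"
      using succ(1) by (auto simp: path_design_def q_def add_mult_distrib)
    have "\<exists>X \<D>. path_design (2 * r) (n + c * q + 2 * r) X \<D> \<and> design_embedded W \<C> X \<D>"
      using W(1)
    proof (rule path_design_grow)
      fix S :: "'a set" assume "finite S" "S \<inter> W = {}" "card S = 2 * r"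
      then show "path_decomposable (2 * r) (all_edges S \<union> cross_edges S W)"
        using cW r by (intro path_decomposable_join_succ[where a = "a + c"]) auto
    qed (use r in simp)
    moreover have "2 * r = q + 1" using r by (simp add: q_def)
    then have "n + c * q + 2 * r = m" using succ c by (simp add: algebra_simps)
    ultimately show ?thesis using W(2) design_embedded_trans k by metis
  next
    case pred
    \<comment> \<open>Again \<open>c = b - a - 1\<close>, but now the last step adds
      \<open>2 * r - 2 = q - 1\<close> points.\<close>
    obtain c where c: "b = a + c + 1" using pred(3) by (metis add.assoc add.commute less_natE Suc_eq_plus1)
    obtain W \<C> where W: "path_design (2 * r) (n + c * q) W \<C>" "design_embedded V \<B> W \<C>"
      using multiple[of c] q_def by blast
    then have cW: "finite W" "card W = (a + c) * (2 * r - 1) + 1"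
      using pred(1) by (auto simp: path_design_def q_def add_mult_distrib)
    have "\<exists>X \<D>. path_design (2 * r) (n + c * q + (2 * r - 2)) X \<D> \<and> design_embedded W \<C> X \<D>"
      using W(1)
    proof (rule path_design_grow)
      fix S :: "'a set" assume "finite S" "S \<inter> W = {}" "card S = 2 * r - 2"
      then show "path_decomposable (2 * r) (all_edges S \<union> cross_edges S W)"
        using cW pred(4) a1 by (intro path_decomposable_join_pred[where a = "a + c"]) auto
    qed (use r in simp)
    moreover have "1 + (2 * r - 2) = q" using r by (simp add: q_def)
    then have "n + c * q + (2 * r - 2) = m" using pred c by (simp add: algebra_simps)
    ultimately show ?thesis using W(2) design_embedded_trans k by metis
  qed
qed

end
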